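(* Let $A\in\mathbb{R}^{m\times n}$, $b\in\mathbb{R}^m$, $\gamma>0$ and $k\in\{1,\dots,n\}$. Define $$v^{\mathrm{PR}}=\min_{x\in\mathbb{R}^n,\ z\in\mathcal{Z}}\left\{\|Ax-b\|^2+\gamma\sum_{i=1}^n\frac{x_i^2}{z_i}\right\},\qquad v^{\mathrm{SC}}=\min_{Y\in\mathbb{S}^{n+1}}\left\{\langle C_\gamma,Y\rangle:\ Y_{11}=1,\ Y\in\mathcal{K}\cap\mathbb{S}^{n+1}_+\right\}.$$ Then the SC-SDP relaxation is tighter than the perspective relaxation, i.e., $v^{\mathrm{SC}}\ge v^{\mathrm{PR}}$.
   Context: $\mathbb{S}^{n+1}$ is the space of real symmetric $(n+1)\times(n+1)$ matrices, $\mathbb{S}^{n+1}_+$ its positive semidefinite cone, $\langle U,V\rangle=\mathrm{Tr}(UV^\top)$, $e$ the all-ones vector. For $Y\in\mathbb{S}^{n+1}$ write $Y=\begin{bmatrix}Y_{11}&Y_{12} \\ Y_{21}&Y_{22}\end{bmatrix}$ with $Y_{11}\in\mathbb{R}$, $Y_{22}\in\mathbb{S}^n$; $\operatorname{Diag}(M)$ is the diagonal matrix with the same diagonal as the square matrix $M$. Define $$\mathcal{K}=\left\{Y\in\mathbb{S}^{n+1}:\begin{bmatrix}kY_{11}&Y_{12} \\ Y_{21}&\operatorname{Diag}(Y_{22})\end{bmatrix}\succeq0\right\},\qquad \mathcal{Z}=\{z\in[0,1]^n:\ e^\top z\le k\},$$ $$C_\gamma=\begin{bmatrix}b^\top \\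 -A^\top\end{bmatrix}\begin{bmatrix}b&-A\end{bmatrix}+\begin{bmatrix}0&0^\top \\ 0&\gamma I_n\end{bmatrix}.$$ For nonnegative scalars, $s/0:=0$ if $s=0$ and $s/0:=+\infty$ if $s>0$. Optimal values are understood as infima. Both problems are relaxations of the sparse ridge regression problem $\min\{\|Ax-b\|^2+\gamma\|x\|^2:\|x\|_0\le k\}$. *)

theory Defs
  imports "HOL-Analysis.Analysis"
begin

text \<open>
  Matrices of size \<open>(n+1) \<times> (n+1)\<close> are indexed by \<open>'n option\<close> with \<open>CARD('n) = n\<close>: \<^term>\<open>None\<close> is
  the first row/column, \<^term>\<open>Some i\<close> the row/column \<open>i + 1\<close>.
\<close>

definition block_matrix ::
    "real \<Rightarrow> real ^ 'n \<Rightarrow> real ^ 'n \<Rightarrow> real ^ 'n ^ 'n \<Rightarrow> real ^ ('n::finite option) ^ ('n option)" where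
  "block_matrix a r c M = (\<chi> p q. case (p, q) of
       (None, None) \<Rightarrow> a
     | (None, Some j) \<Rightarrow> r $ j
     | (Some i, None) \<Rightarrow> c $ i
     | (Some i, Some j) \<Rightarrow> M $ i $ j)"

definition block11 :: "real ^ ('n::finite option) ^ ('n option) \<Rightarrow> real" where
  "block11 Y = Y $ None $ None"

definition block12 :: "real ^ ('n::finite option) ^ ('n option) \<Rightarrow> real ^ 'n" where
  "block12 Y = (\<chi> j. Y $ None $ Some j)"

definition block21 :: "real ^ ('n::finite option) ^ ('n option) \<Rightarrow> real ^ 'n" where
  "block21 Y = (\<chi> i. Y $ Some i $ None)"

definition block22 :: "real ^ ('n::finite option) ^ ('n option) \<Rightarrow> real ^ 'n ^ 'n" where
  "block22 Y = (\<chi> i j. Y $ Some i $ Some j)"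

definition Diag :: "real ^ 'n ^ 'n \<Rightarrow> real ^ 'n ^ 'n" where
  "Diag M = (\<chi> i j. if i = j then M $ i $ i else 0)"

definition sym_matrices :: "(real ^ 'n ^ 'n) set" where
  "sym_matrices = {Y. transpose Y = Y}"

definition psd_cone :: "(real ^ 'n ^ 'n) set" where
  "psd_cone = {Y \<in> sym_matrices. \<forall>v. 0 \<le> v \<bullet> (Y *v v)}"

definition matrix_inner :: "real ^ 'n ^ 'n \<Rightarrow> real ^ 'n ^ 'n \<Rightarrow> real" where
  "matrix_inner U V = trace (U ** transpose V)"

definition K_set :: "nat \<Rightarrow> (real ^ ('n::finite option) ^ ('n option)) set" where
  "K_set k = {Y \<in> sym_matrices.
     block_matrix (real k * block11 Y) (block12 Y) (block21 Y) (Diag (block22 Y)) \<in> psd_cone}"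

definition Z_set :: "nat \<Rightarrow> (real ^ 'n) set" where
  "Z_set k = {z. (\<forall>i. z $ i \<in> {0..1}) \<and> (\<Sum>i\<in>UNIV. z $ i) \<le> real k}"

text \<open>The \<open>m \<times> (n+1)\<close> matrix \<open>[b  -A]\<close>.\<close>

definition data_matrix :: "real ^ 'n ^ 'm \<Rightarrow> real ^ 'm \<Rightarrow> real ^ ('n option) ^ 'm" where
  "data_matrix A b = (\<chi> i q. case q of None \<Rightarrow> b $ i | Some j \<Rightarrow> - A $ i $ j)"

definition C_matrix ::
    "real ^ 'n ^ 'm \<Rightarrow> real ^ 'm \<Rightarrow> real \<Rightarrow> real ^ ('n::finite option) ^ ('n option)" where
  "C_matrix A b \<gamma> =
     transpose (data_matrix A b) ** data_matrix A b + block_matrix 0 0 0 (\<gamma> *\<^sub>R mat 1)"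

text \<open>
  Division on \<^typ>\<open>ereal\<close> already obeys the convention \<open>0/0 = 0\<close> and \<open>s/0 = \<infinity>\<close> for \<open>s > 0\<close>.
\<close>

lemma ereal_divide_zero_convention:
  "ereal s / ereal 0 = (if s = 0 then 0 else \<infinity>)" if "s \<ge> 0"
  using that by (simp add: divide_ereal_def)

lemma ereal_divide_nonzero: "ereal s / ereal t = ereal (s / t)" if "t \<noteq> 0"
  using that by simp

definition PR_objective ::
    "real ^ 'n ^ 'm \<Rightarrow> real ^ 'm \<Rightarrow> real \<Rightarrow> real ^ 'n \<Rightarrow> real ^ 'n \<Rightarrow> ereal" where
  "PR_objective A b \<gamma> x z =
     ereal ((norm (A *v x - b))\<^sup>2) + ereal \<gamma> * (\<Sum>i\<in>UNIV. ereal ((x $ i)\<^sup>2) / ereal (z $ i))"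

definition v_PR :: "real ^ 'n ^ 'm \<Rightarrow> real ^ 'm \<Rightarrow> real \<Rightarrow> nat \<Rightarrow> ereal" where
  "v_PR A b \<gamma> k = (INF (x, z) \<in> UNIV \<times> Z_set k. PR_objective A b \<gamma> x z)"

definition v_SC :: "real ^ 'n ^ 'm \<Rightarrow> real ^ 'm \<Rightarrow> real \<Rightarrow> nat \<Rightarrow> ereal" where
  "v_SC A b \<gamma> k =
     (INF Y \<in> {Y. block11 Y = 1 \<and> Y \<in> K_set k \<inter> psd_cone}. ereal (matrix_inner (C_matrix A b \<gamma>) Y))"

end

theory Submission
  imports Defs
begin

text \<open>
  A feasible \<open>Y\<close> of the SDP yields the point \<open>x = Y\<^sub>2\<^sub>1\<close>, \<open>z\<^sub>i = x\<^sub>i\<^sup>2 / Y\<^sub>i\<^sub>i\<close> (with \<open>0 / 0 = 0\<close>) of the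
  perspective relaxation, whose objective value is no larger: \<open>Y \<succeq> 0\<close> gives \<open>x\<^sub>i\<^sup>2 \<le> Y\<^sub>i\<^sub>i\<close>, hence
  \<open>z \<le> 1\<close>; the Schur complement of the matrix defining \<open>\<K>\<close> gives \<open>\<Sum>\<^sub>i z\<^sub>i \<le> k\<close>; clearly
  \<open>x\<^sub>i\<^sup>2 / z\<^sub>i \<le> Y\<^sub>i\<^sub>i\<close>; and \<open>\<parallel>A x - b\<parallel>\<^sup>2\<close> is bounded by the data term of the SDP, row by row, since
  \<open>Y - y y\<^sup>T \<succeq> 0\<close> for the first column \<open>y\<close> of \<open>Y\<close>.
\<close>

lemma sum_UNIV_option:
  fixes f :: "'n::finite option \<Rightarrow> 'a::comm_monoid_add"
  shows "(\<Sum>q\<in>UNIV. f q) = f None + (\<Sum>i\<in>UNIV. f (Some i))"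
  by (simp add: UNIV_option_conv sum.reindex)

lemma psd_cone_symD: "Y $ i $ j = Y $ j $ i" if "Y \<in> psd_cone"
proof -
  have "transpose Y = Y"
    using that by (simp add: psd_cone_def sym_matrices_def)
  then show ?thesis
    by (metis transpose_def vec_lambda_beta)
qed

text \<open>The form of \<open>Y\<close> at \<open>u - t v\<close> is a quadratic in
  \<open>t\<close> that is never negative. Its value at the minimizer \<open>t = b / c\<close> is
  the inequality; for \<open>c = 0\<close> it is affine and must be constant.\<close>

lemma psd_cone_cauchy_schwarz:
  fixes Y :: "real ^ 'n ^ 'n"
  assumes Y: "Y \<in> psd_cone"
  shows "(u \<bullet> (Y *v v))\<^sup>2 \<le> (u \<bullet> (Y *v u)) * (v \<bullet> (Y *v v))"
proof -
  define a b c where "a = u \<bullet> (Y *v u)" and "b = u \<bullet> (Y *v v)" and "c = v \<bullet> (Y *v v)"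
  have "transpose Y = Y"
    using Y by (simp add: psd_cone_def sym_matrices_def)
  then have sym: "v \<bullet> (Y *v u) = b"
    by (metis b_def dot_lmul_matrix inner_commute transpose_matrix_vector)
  have quad: "0 \<le> a - 2 * t * b + t\<^sup>2 * c" for t
  proof -
    have "0 \<le> (u - t *\<^sub>R v) \<bullet> (Y *v (u - t *\<^sub>R v))"
      using Y by (simp add: psd_cone_def)
    also have "\<dots> = a - 2 * t * b + t\<^sup>2 * c"
      using sym
      by (simp add: matrix_vector_mult_diff_distrib matrix_vector_mult_scaleR inner_diff_left
          inner_diff_right a_def b_def c_def power2_eq_square algebra_simps)
    finally show ?thesis .
  qed
  have "0 \<le> c"
    using Y by (simp add: psd_cone_def c_def)
  have "b\<^sup>2 \<le> a * c"
  proof (cases "c = 0")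
    case True
    have "b = 0"
    proof (rule ccontr)
      assume "b \<noteq> 0"
      \<comment> \<open>With \<open>c = 0\<close> the bound reads \<open>a - 2 t b\<close>, and this
        \<open>t\<close> makes it -1.\<close>
      then show False
        using quad[of "(a + 1) / (2 * b)"] True by simp
    qed
    then show ?thesis
      using True by simp
  next
    case False
    with \<open>0 \<le> c\<close> quad[of "b / c"] show ?thesis
      by (simp add: field_simps power2_eq_square)
  qed
  then show ?thesis
    by (simp add: a_def b_def c_def)
qed

lemma inner_axis_matrix_axis:
  fixes Y :: "real ^ 'n ^ 'm"
  shows "axis i 1 \<bullet> (Y *v axis j 1) = Y $ i $ j"
  by (simp add: inner_axis' matrix_vector_mul_component inner_axis)

text \<open>The trace is cyclic, and the diagonal entries of
  \<open>D ** transpose Y ** transpose D\<close> are the quadratic forms of \<open>Y\<close> at the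
  rows of \<open>D\<close>.\<close>

lemma matrix_inner_gram:
  fixes D :: "real ^ 'n ^ 'm" and Y :: "real ^ 'n ^ 'n"
  shows "matrix_inner (transpose D ** D) Y = (\<Sum>i\<in>UNIV. D $ i \<bullet> (Y *v D $ i))"
proof -
  have "matrix_inner (transpose D ** D) Y = trace ((D ** transpose Y) ** transpose D)"
    by (metis matrix_inner_def matrix_mul_assoc trace_mul_sym)
  also have "\<dots> = (\<Sum>i\<in>UNIV. D $ i \<bullet> (Y *v D $ i))"
    by (simp add: trace_def matrix_matrix_mult_def transpose_def inner_vec_def
        matrix_vector_mult_def mult.commute)
  finally show ?thesis .
qed

lemma matrix_inner_C_matrix:
  "matrix_inner (C_matrix A b \<gamma>) Y =
     (\<Sum>i\<in>UNIV. data_matrix A b $ i \<bullet> (Y *v data_matrix A b $ i))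
       + \<gamma> * (\<Sum>i\<in>UNIV. Y $ Some i $ Some i)"
proof -
  have "matrix_inner (block_matrix 0 0 0 (\<gamma> *\<^sub>R mat 1)) Y = \<gamma> * (\<Sum>i\<in>UNIV. Y $ Some i $ Some i)"
    by (simp add: matrix_inner_def trace_def matrix_matrix_mult_def transpose_def
        sum_UNIV_option block_matrix_def mat_def if_distrib if_distribR sum_distrib_left
        cong: if_cong)
  moreover have "matrix_inner (U + V) Y = matrix_inner U Y + matrix_inner V Y" for U V
    by (simp add: matrix_inner_def trace_def matrix_matrix_mult_def sum.distrib distrib_right)
  ultimately show ?thesis
    by (simp add: C_matrix_def matrix_inner_gram)
qed

lemma norm_residual_le:
  fixes A :: "real ^ 'n ^ 'm" and Y :: "real ^ ('n option) ^ ('n option)"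
  assumes Y: "Y \<in> psd_cone" and one: "block11 Y = 1"
  shows "(norm (A *v block21 Y - b))\<^sup>2
    \<le> (\<Sum>i\<in>UNIV. data_matrix A b $ i \<bullet> (Y *v data_matrix A b $ i))"
proof -
  define y where "y = Y *v axis None 1"
  have y: "y $ q = Y $ q $ None" for q
    unfolding y_def by (metis inner_axis_matrix_axis inner_axis' inner_real_def mult_1)
  \<comment> \<open>Since \<open>block11 Y = 1\<close>, the first column is
    \<open>y = (1, x)\<close>, so \<open>[b -A] y = b - A x\<close>.\<close>
  have res: "(A *v block21 Y - b) $ i = - (data_matrix A b $ i \<bullet> y)" for i
    using one
    by (simp add: inner_vec_def sum_UNIV_option y data_matrix_def block11_def block21_def
        matrix_vector_mult_def sum_negf)
  have "(norm v)\<^sup>2 = (\<Sum>i\<in>UNIV. (v $ i)\<^sup>2)" for v :: "real ^ 'm"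
    by (simp add: power2_norm_eq_inner inner_vec_def flip: power2_eq_square)
  then have "(norm (A *v block21 Y - b))\<^sup>2 = (\<Sum>i\<in>UNIV. (data_matrix A b $ i \<bullet> y)\<^sup>2)"
    by (simp only: res power2_minus)
  also have "\<dots> \<le> (\<Sum>i\<in>UNIV. data_matrix A b $ i \<bullet> (Y *v data_matrix A b $ i))"
    \<comment> \<open>The factor at \<open>axis None 1\<close> is \<open>block11 Y = 1\<close>,
      which leaves the square bounded by the form at the row alone.\<close>
    using psd_cone_cauchy_schwarz[OF Y, of _ "axis None 1"] one
    by (intro sum_mono) (simp add: y_def inner_axis_matrix_axis block11_def)
  finally show ?thesis .
qed

lemma inner_block_matrix_Diag:
  fixes w :: "real ^ ('n::finite option)"
  shows "w \<bullet> (block_matrix a r c (Diag M) *v w) =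
    a * (w $ None)\<^sup>2 + (\<Sum>i\<in>UNIV. (r $ i + c $ i) * (w $ None * w $ Some i))
      + (\<Sum>i\<in>UNIV. M $ i $ i * (w $ Some i)\<^sup>2)"
proof -
  have "(\<Sum>j\<in>UNIV. w $ Some j * (w $ Some i * Diag M $ i $ j)) = M $ i $ i * (w $ Some i)\<^sup>2" for i
    by (simp add: Diag_def if_distrib if_distribR power2_eq_square cong: if_cong)
  then show ?thesis
    by (simp add: inner_vec_def matrix_vector_mult_def sum_UNIV_option block_matrix_def
        sum.distrib sum_distrib_left algebra_simps power2_eq_square)
qed

lemma sum_ratio_le:
  assumes psd: "block_matrix a r r (Diag M) \<in> psd_cone"
  shows "(\<Sum>i\<in>UNIV. (r $ i)\<^sup>2 / M $ i $ i) \<le> a"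
proof -
  \<comment> \<open>For \<open>M $ i $ i > 0\<close> this entry minimizes the form with first
    coordinate 1, so its value there is the Schur complement. For \<open>M $ i $ i = 0\<close>
    division gives 0, and the index contributes nothing on either side.\<close>
  define w where "w = (\<chi> q. case q of None \<Rightarrow> 1 | Some i \<Rightarrow> - (r $ i / M $ i $ i))"
  have "0 \<le> w \<bullet> (block_matrix a r r (Diag M) *v w)"
    using psd by (simp add: psd_cone_def)
  also have "\<dots> = a + (\<Sum>i\<in>UNIV. (r $ i + r $ i) * - (r $ i / M $ i $ i)
      + M $ i $ i * (r $ i / M $ i $ i)\<^sup>2)"
    by (simp add: inner_block_matrix_Diag w_def sum.distrib sum_subtractf sum_negf)
  also have "\<dots> = a + (\<Sum>i\<in>UNIV. - ((r $ i)\<^sup>2 / M $ i $ i))"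
    by (intro arg_cong[where f = "(+) a"] sum.cong refl)
      (auto simp: field_simps power2_eq_square)
  finally show ?thesis
    by (simp add: sum_negf)
qed

text \<open>The bound on \<open>x\<^sup>2\<close> forces \<open>x = 0\<close> when
  \<open>d = 0\<close>, which excludes the value \<infinity>.\<close>

lemma ratio_divide_le:
  fixes x d :: real
  assumes "0 \<le> d" "x\<^sup>2 \<le> d"
  shows "ereal (x\<^sup>2) / ereal (x\<^sup>2 / d) \<le> ereal d"
  using assms by (cases "x = 0"; cases "d = 0") (auto simp: ereal_divide_zero_convention)

theorem proposition4:
  fixes A :: "real ^ 'n ^ 'm" and b :: "real ^ 'm" and \<gamma> :: real and k :: nat
  assumes "\<gamma> > 0" and "k \<in> {1..CARD('n)}"
  shows "v_SC A b \<gamma> k \<ge> v_PR A b \<gamma> k"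
  unfolding v_SC_def
proof (rule INF_greatest)
  fix Y :: "real ^ ('n option) ^ ('n option)"
  assume "Y \<in> {Y. block11 Y = 1 \<and> Y \<in> K_set k \<inter> psd_cone}"
  then have one: "block11 Y = 1" and K: "Y \<in> K_set k" and psd: "Y \<in> psd_cone"
    by auto
  define x where "x = block21 Y"
  define d where "d i = Y $ Some i $ Some i" for i
  define z where "z = (\<chi> i. (x $ i)\<^sup>2 / d i)"
  have row: "block12 Y = x"
    using psd_cone_symD[OF psd] by (simp add: x_def block12_def block21_def vec_eq_iff)
  \<comment> \<open>This is the 2 by 2 principal minor on \<open>None\<close> and
    \<open>Some i\<close>, with corner entry 1.\<close>
  have x_le: "(x $ i)\<^sup>2 \<le> d i" for i
    using psd_cone_cauchy_schwarz[OF psd, of "axis (Some i) 1" "axis None 1"] one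
    by (simp add: inner_axis_matrix_axis x_def d_def block21_def block11_def)
  then have d_nonneg: "0 \<le> d i" for i
    using order_trans zero_le_power2 by blast
  have "(\<Sum>i\<in>UNIV. z $ i) \<le> real k"
    using sum_ratio_le[of "real k" x "block22 Y"] K one row
    by (simp add: K_set_def z_def d_def block22_def flip: x_def)
  moreover have "z $ i \<in> {0..1}" for i
    using x_le[of i] d_nonneg[of i] by (auto simp: z_def divide_le_eq_1)
  ultimately have "z \<in> Z_set k"
    by (simp add: Z_set_def)
  then have "v_PR A b \<gamma> k \<le> PR_objective A b \<gamma> x z"
    unfolding v_PR_def by (intro INF_lower2[of "(x, z)"]) auto
  also have "\<dots> \<le> ereal (\<Sum>i\<in>UNIV. data_matrix A b $ i \<bullet> (Y *v data_matrix A b $ i))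
      + ereal \<gamma> * (\<Sum>i\<in>UNIV. ereal (d i))"
    unfolding PR_objective_def
    using norm_residual_le[OF psd one, of A b] ratio_divide_le[OF d_nonneg x_le] \<open>\<gamma> > 0\<close>
    by (intro add_mono ereal_mult_left_mono sum_mono) (simp_all add: z_def x_def)
  also have "\<dots> = ereal (matrix_inner (C_matrix A b \<gamma>) Y)"
    by (simp add: matrix_inner_C_matrix d_def)
  finally show "v_PR A b \<gamma> k \<le> ereal (matrix_inner (C_matrix A b \<gamma>) Y)" .
qed

end
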